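(* Let $R$ be a finite Frobenius ring with unity (not assumed commutative), let $n$ be a positive integer, and let $C$ and $D$ be two linear codes in $R^n$ (i.e. right $R$-submodules of $R^n$) such that $|C||D|=|R^n|$. Then the following are equivalent: (1) the pair $(C,D)$ is LCP; (2) $C\oplus D$ is an essential submodule of $R^n$ (that is, $C\cap D=\{0\}$ and $C+D$ is essential in $R^n$); (3) $0$ is a complement of $C\oplus D$ in $R^n$ (that is, $C\cap D=\{0\}$ and $0$ is a complement of $C+D$); (4) $D$ is a complement of $C$ in $R^n$; (5) $C\oplus D$ is closed in $R^n$ (that is, $C\cap D=\{0\}$ and $C+D$ is closed in $R^n$).
   Context: A finite ring $R$ is Frobenius if it is right and left self-injective and $R/J(R)\cong \mathrm{Soc}(R)$ as right $R$-modules, where $J(R)$ is the Jacobson radical. A linear code of length $n$ over $R$ is a right $R$-submodule of $R^n$. The pair $(C,D)$ is LCP (a linear complementary pair) if $C\oplus D=R^n$, i.e. $C+D=R^n$ and $C\cap D=\{0\}$. A right $R$-submodule $A$ of $R^n$ is essential if $A\cap M\neq 0$ for every nonzero right $R$-submodule $M$ of $R^n$. For right $R$-submodules $A,B$ of $R^n$, $B$ is a complement (submodule) of $A$ in $R^n$ if $B$ is maximal among right $R$-submodules of $R^n$ with respect to $A\cap B=\{0\}$. A right $R$-submodule of $R^n$ is closed in $R^n$ if it is the complement of some right $R$-submodule of $R^n$. Writing $C\oplus D$ means the internal direct sum, so it includes the assertion $C\cap D=\{0\}$. *)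

theory Defs
  imports "HOL-Algebra.Module" "HOL-Algebra.AbelCoset" "HOL-Algebra.Generated_Groups"
begin

section \<open>Right modules over a not necessarily commutative ring\<close>

text \<open>The record \<open>module\<close> of HOL-Algebra is used there for left modules over commutative rings.
  Here scalars act on the right. As in that record, the inherited fields \<open>mult\<close> and \<open>one\<close> of a
  module are irrelevant.\<close>

record ('a, 'b) right_module = "'b ring" +
  rsmult :: "['b, 'a] \<Rightarrow> 'b" (infixl \<open>\<odot>\<^sub>r\<index>\<close> 70)

locale right_module = R?: ring R + M?: abelian_group M
  for R :: "('a, 'c) ring_scheme" (structure)
    and M :: "('a, 'b, 'd) right_module_scheme" (structure) +
  assumes rsmult_closed:
      "\<lbrakk> x \<in> carrier M; a \<in> carrier R \<rbrakk> \<Longrightarrow> x \<odot>\<^sub>r\<^bsub>M\<^esub> a \<in> carrier M"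
    and rsmult_l_distr:
      "\<lbrakk> x \<in> carrier M; y \<in> carrier M; a \<in> carrier R \<rbrakk> \<Longrightarrow>
       (x \<oplus>\<^bsub>M\<^esub> y) \<odot>\<^sub>r\<^bsub>M\<^esub> a = (x \<odot>\<^sub>r\<^bsub>M\<^esub> a) \<oplus>\<^bsub>M\<^esub> (y \<odot>\<^sub>r\<^bsub>M\<^esub> a)"
    and rsmult_r_distr:
      "\<lbrakk> x \<in> carrier M; a \<in> carrier R; b \<in> carrier R \<rbrakk> \<Longrightarrow>
       x \<odot>\<^sub>r\<^bsub>M\<^esub> (a \<oplus>\<^bsub>R\<^esub> b) = (x \<odot>\<^sub>r\<^bsub>M\<^esub> a) \<oplus>\<^bsub>M\<^esub> (x \<odot>\<^sub>r\<^bsub>M\<^esub> b)"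
    and rsmult_assoc:
      "\<lbrakk> x \<in> carrier M; a \<in> carrier R; b \<in> carrier R \<rbrakk> \<Longrightarrow>
       x \<odot>\<^sub>r\<^bsub>M\<^esub> (a \<otimes>\<^bsub>R\<^esub> b) = (x \<odot>\<^sub>r\<^bsub>M\<^esub> a) \<odot>\<^sub>r\<^bsub>M\<^esub> b"
    and rsmult_one:
      "x \<in> carrier M \<Longrightarrow> x \<odot>\<^sub>r\<^bsub>M\<^esub> \<one>\<^bsub>R\<^esub> = x"

definition right_submodule ::
  "('a, 'c) ring_scheme \<Rightarrow> ('a, 'b, 'd) right_module_scheme \<Rightarrow> 'b set \<Rightarrow> bool" where
  "right_submodule R M N \<longleftrightarrow>
     additive_subgroup N M \<and> (\<forall>x\<in>N. \<forall>a\<in>carrier R. x \<odot>\<^sub>r\<^bsub>M\<^esub> a \<in> N)"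

definition right_module_hom ::
  "('a, 'c) ring_scheme \<Rightarrow> ('a, 'b, 'd) right_module_scheme \<Rightarrow> ('a, 'e, 'f) right_module_scheme
    \<Rightarrow> ('b \<Rightarrow> 'e) set" where
  "right_module_hom R M N =
     {f \<in> carrier M \<rightarrow> carrier N.
        (\<forall>x\<in>carrier M. \<forall>y\<in>carrier M. f (x \<oplus>\<^bsub>M\<^esub> y) = f x \<oplus>\<^bsub>N\<^esub> f y) \<and>
        (\<forall>x\<in>carrier M. \<forall>a\<in>carrier R. f (x \<odot>\<^sub>r\<^bsub>M\<^esub> a) = f x \<odot>\<^sub>r\<^bsub>N\<^esub> a)}"

definition right_module_iso ::
  "('a, 'c) ring_scheme \<Rightarrow> ('a, 'b, 'd) right_module_scheme \<Rightarrow> ('a, 'e, 'f) right_module_scheme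
    \<Rightarrow> bool" where
  "right_module_iso R M N \<longleftrightarrow>
     (\<exists>f \<in> right_module_hom R M N. bij_betw f (carrier M) (carrier N))"

definition quotient_right_module ::
  "('a, 'b, 'd) right_module_scheme \<Rightarrow> 'b set \<Rightarrow> ('a, 'b set) right_module" where
  "quotient_right_module M N =
     \<lparr>carrier = a_rcosets\<^bsub>M\<^esub> N, mult = undefined, one = undefined,
      zero = N, add = set_add M,
      rsmult = (\<lambda>A a. \<Union>x\<in>A. N +>\<^bsub>M\<^esub> (x \<odot>\<^sub>r\<^bsub>M\<^esub> a))\<rparr>"

definition regular_right_module :: "('a, 'c) ring_scheme \<Rightarrow> ('a, 'a) right_module" where
  "regular_right_module R =
     \<lparr>carrier = carrier R, mult = mult R, one = one R, zero = zero R, add = add R,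
      rsmult = mult R\<rparr>"

text \<open>The right module \<open>R\<^sup>n\<close>, with vectors as extensional functions on \<open>{..<n}\<close>.\<close>

definition free_right_module ::
  "('a, 'c) ring_scheme \<Rightarrow> nat \<Rightarrow> ('a, nat \<Rightarrow> 'a) right_module" where
  "free_right_module R n =
     \<lparr>carrier = {..<n} \<rightarrow>\<^sub>E carrier R, mult = undefined, one = undefined,
      zero = (\<lambda>i\<in>{..<n}. \<zero>\<^bsub>R\<^esub>), add = (\<lambda>x y. \<lambda>i\<in>{..<n}. x i \<oplus>\<^bsub>R\<^esub> y i),
      rsmult = (\<lambda>x a. \<lambda>i\<in>{..<n}. x i \<otimes>\<^bsub>R\<^esub> a)\<rparr>"


section \<open>Frobenius rings\<close>

text \<open>HOL cannot quantify over modules of all types inside a formula, so the modules tested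
  have their elements in the type \<open>'m\<close>. The choice is immaterial as soon as \<open>'m\<close> contains
  a copy of the ring: by Baer's criterion it suffices to extend homomorphisms from the right
  ideals of the ring to the ring.\<close>

definition injective_right_module ::
  "'m itself \<Rightarrow> ('a, 'c) ring_scheme \<Rightarrow> ('a, 'b, 'd) right_module_scheme \<Rightarrow> bool" where
  "injective_right_module (_ :: 'm itself) R E \<longleftrightarrow>
     right_module R E \<and>
     (\<forall>(M :: ('a, 'm) right_module) (N :: ('a, 'm) right_module) f g.
        right_module R M \<and> right_module R N \<and>
        f \<in> right_module_hom R M N \<and> inj_on f (carrier M) \<and> g \<in> right_module_hom R M E \<longrightarrow>
        (\<exists>h \<in> right_module_hom R N E. \<forall>x\<in>carrier M. h (f x) = g x))"

text \<open>The test modules live in the type of the vectors over \<open>R\<close>, which contains \<open>R\<close> (as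
  constant functions) and all the modules \<open>R\<^sup>n\<close>.\<close>

definition right_self_injective :: "('a, 'c) ring_scheme \<Rightarrow> bool" where
  "right_self_injective R \<longleftrightarrow>
     injective_right_module TYPE(nat \<Rightarrow> 'a) R (regular_right_module R)"

definition opposite_ring :: "('a, 'c) ring_scheme \<Rightarrow> ('a, 'c) ring_scheme" where
  "opposite_ring R = R\<lparr>mult := (\<lambda>x y. y \<otimes>\<^bsub>R\<^esub> x)\<rparr>"

text \<open>Left modules over \<open>R\<close> are right modules over the opposite ring.\<close>

definition left_self_injective :: "('a, 'c) ring_scheme \<Rightarrow> bool" where
  "left_self_injective R \<longleftrightarrow> right_self_injective (opposite_ring R)"

definition maximal_right_ideal :: "('a, 'c) ring_scheme \<Rightarrow> 'a set \<Rightarrow> bool" where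
  "maximal_right_ideal R I \<longleftrightarrow>
     right_submodule R (regular_right_module R) I \<and> I \<noteq> carrier R \<and>
     (\<forall>K. right_submodule R (regular_right_module R) K \<and> I \<subseteq> K \<longrightarrow> K = I \<or> K = carrier R)"

text \<open>Intersecting with the carrier matters only for the zero ring.\<close>

definition jacobson_radical :: "('a, 'c) ring_scheme \<Rightarrow> 'a set" where
  "jacobson_radical R = carrier R \<inter> \<Inter>{I. maximal_right_ideal R I}"

definition simple_right_submodule ::
  "('a, 'c) ring_scheme \<Rightarrow> ('a, 'b, 'd) right_module_scheme \<Rightarrow> 'b set \<Rightarrow> bool" where
  "simple_right_submodule R M S \<longleftrightarrow>
     right_submodule R M S \<and> S \<noteq> {\<zero>\<^bsub>M\<^esub>} \<and>
     (\<forall>N. right_submodule R M N \<and> N \<subseteq> S \<longrightarrow> N = {\<zero>\<^bsub>M\<^esub>} \<or> N = S)"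

text \<open>The socle is the sum of all simple submodules, that is, the additive group they generate.\<close>

definition right_socle ::
  "('a, 'c) ring_scheme \<Rightarrow> ('a, 'b, 'd) right_module_scheme \<Rightarrow> 'b set" where
  "right_socle R M = generate (add_monoid M) (\<Union>{S. simple_right_submodule R M S})"

definition frobenius_ring :: "('a, 'c) ring_scheme \<Rightarrow> bool" where
  "frobenius_ring R \<longleftrightarrow>
     ring R \<and> right_self_injective R \<and> left_self_injective R \<and>
     right_module_iso R
       (quotient_right_module (regular_right_module R) (jacobson_radical R))
       ((regular_right_module R)\<lparr>carrier := right_socle R (regular_right_module R)\<rparr>)"


section \<open>Essential, complement and closed submodules\<close>

definition essential_submodule ::
  "('a, 'c) ring_scheme \<Rightarrow> ('a, 'b, 'd) right_module_scheme \<Rightarrow> 'b set \<Rightarrow> bool" where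
  "essential_submodule R M A \<longleftrightarrow>
     right_submodule R M A \<and>
     (\<forall>N. right_submodule R M N \<and> N \<noteq> {\<zero>\<^bsub>M\<^esub>} \<longrightarrow> A \<inter> N \<noteq> {\<zero>\<^bsub>M\<^esub>})"

text \<open>\<open>complement_submodule R M A B\<close>: the submodule \<open>B\<close> is a complement of \<open>A\<close> in \<open>M\<close>.\<close>

definition complement_submodule ::
  "('a, 'c) ring_scheme \<Rightarrow> ('a, 'b, 'd) right_module_scheme \<Rightarrow> 'b set \<Rightarrow> 'b set \<Rightarrow> bool" where
  "complement_submodule R M A B \<longleftrightarrow>
     right_submodule R M A \<and> right_submodule R M B \<and> A \<inter> B = {\<zero>\<^bsub>M\<^esub>} \<and>
     (\<forall>B'. right_submodule R M B' \<and> A \<inter> B' = {\<zero>\<^bsub>M\<^esub>} \<and> B \<subseteq> B' \<longrightarrow> B' = B)"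

definition closed_submodule ::
  "('a, 'c) ring_scheme \<Rightarrow> ('a, 'b, 'd) right_module_scheme \<Rightarrow> 'b set \<Rightarrow> bool" where
  "closed_submodule R M B \<longleftrightarrow> (\<exists>A. right_submodule R M A \<and> complement_submodule R M A B)"


section \<open>Linear codes\<close>

definition linear_code :: "('a, 'c) ring_scheme \<Rightarrow> nat \<Rightarrow> (nat \<Rightarrow> 'a) set \<Rightarrow> bool" where
  "linear_code R n C \<longleftrightarrow> right_submodule R (free_right_module R n) C"

definition lcp :: "('a, 'c) ring_scheme \<Rightarrow> nat \<Rightarrow> (nat \<Rightarrow> 'a) set \<Rightarrow> (nat \<Rightarrow> 'a) set \<Rightarrow> bool" where
  "lcp R n C D \<longleftrightarrow>
     C <+>\<^bsub>free_right_module R n\<^esub> D = carrier (free_right_module R n) \<and>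
     C \<inter> D = {\<zero>\<^bsub>free_right_module R n\<^esub>}"

end

theory Submission
  imports Defs
begin

text \<open>If \<open>C \<inter> D = 0\<close>, then the addition map \<open>C \<times> D \<rightarrow> R\<^sup>n\<close> is injective, hence by the assumption on the
  cardinalities bijective. So each of the five conditions amounts to \<open>C \<inter> D = 0\<close>; for (4), if
  \<open>D \<subseteq> B\<close>, \<open>C \<inter> B = 0\<close> and \<open>b = c + d\<close>, then \<open>c = b - d \<in> C \<inter> B\<close>, so \<open>b = d\<close>.\<close>

lemma (in abelian_group) set_add_eq_carrier_if_card:
  assumes C: "additive_subgroup C G" and D: "additive_subgroup D G"
    and fin: "finite (carrier G)" and card: "card C * card D = card (carrier G)"
    and int: "C \<inter> D = {\<zero>}"
  shows "C <+>\<^bsub>G\<^esub> D = carrier G"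
proof -
  interpret C: additive_subgroup C G by fact
  interpret D: additive_subgroup D G by fact
  have "inj_on (\<lambda>(x, y). x \<oplus> y) (C \<times> D)"
  proof (intro inj_onI, clarify)
    fix x y x' y'
    assume x: "x \<in> C" "x' \<in> C" and y: "y \<in> D" "y' \<in> D" and eq: "x \<oplus> y = x' \<oplus> y'"
    have car: "x \<in> carrier G" "x' \<in> carrier G" "y \<in> carrier G" "y' \<in> carrier G"
      using x y by auto
    \<comment> \<open>Inserting \<open>y \<ominus> y\<close> makes the sum
      \<open>x \<oplus> y\<close> appear, so that \<open>eq\<close> can be applied; the same
      regrouping read backwards then isolates \<open>y' \<ominus> y\<close>.\<close>
    have "x \<ominus> x' = (x \<ominus> x') \<oplus> (y \<ominus> y)"
      using car by (simp add: r_neg a_minus_def)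
    also have "\<dots> = (x \<oplus> y) \<ominus> (x' \<oplus> y)"
      using car by (simp add: a_minus_def minus_add a_ac)
    also have "\<dots> = (x' \<oplus> y') \<ominus> (x' \<oplus> y)"
      by (simp only: eq)
    also have "\<dots> = (x' \<ominus> x') \<oplus> (y' \<ominus> y)"
      using car by (simp add: a_minus_def minus_add a_ac)
    also have "\<dots> = y' \<ominus> y"
      using car by (simp add: r_neg a_minus_def)
    finally have "x \<ominus> x' = y' \<ominus> y" .
    moreover have "x \<ominus> x' \<in> C" "y' \<ominus> y \<in> D"
      using x y by (simp_all add: a_minus_def)
    ultimately have "x \<ominus> x' = \<zero>" "y' \<ominus> y = \<zero>"
      using int by auto
    then show "x = x' \<and> y = y'"
      using car by (metis a_minus_def add.inv_closed minus_equality r_neg)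
  qed
  moreover have img: "C <+>\<^bsub>G\<^esub> D = (\<lambda>(x, y). x \<oplus> y) ` (C \<times> D)"
    by (auto simp: set_add_def set_mult_def)
  ultimately have "card (C <+>\<^bsub>G\<^esub> D) = card (carrier G)"
    using card by (simp add: card_image card_cartesian_product)
  \<comment> \<open>A subset of a finite set with the same cardinality is the whole set.\<close>
  moreover have "C <+>\<^bsub>G\<^esub> D \<subseteq> carrier G"
    unfolding img by auto
  ultimately show ?thesis
    using card_subset_eq[OF fin] by blast
qed

text \<open>An instance of the modular law: since \<open>D \<subseteq> B\<close>, one has B = B
  \<inter> (C + D) = (B \<inter> C) + D = D.\<close>

lemma (in abelian_group) eq_if_disjoint_summand_le:
  assumes C: "additive_subgroup C G" and D: "additive_subgroup D G" and B: "additive_subgroup B G"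
    and sum: "C <+>\<^bsub>G\<^esub> D = carrier G" and int: "C \<inter> B = {\<zero>}" and le: "D \<subseteq> B"
  shows "B = D"
proof
  interpret C: additive_subgroup C G by fact
  interpret D: additive_subgroup D G by fact
  interpret B: additive_subgroup B G by fact
  show "B \<subseteq> D"
  proof
    fix b assume b: "b \<in> B"
    then have "b \<in> C <+>\<^bsub>G\<^esub> D" using sum by auto
    then obtain c d where cd: "c \<in> C" "d \<in> D" "b = c \<oplus> d"
      by (auto simp: set_add_def set_mult_def)
    have "c = b \<ominus> d" using cd by (simp add: a_minus_def a_assoc r_neg)
    also have "\<dots> \<in> B" using b cd le by (auto simp: a_minus_def)
    finally have "c = \<zero>" using cd int by auto
    then show "b \<in> D" using cd by simp
  qed
qed (fact le)

context right_module
begin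

text \<open>Cancel in 0a = (0 + 0)a = 0a + 0a. This is what makes the zero subgroup stable under
  scalars.\<close>

lemma zero_rsmult: "a \<in> carrier R \<Longrightarrow> \<zero>\<^bsub>M\<^esub> \<odot>\<^sub>r\<^bsub>M\<^esub> a = \<zero>\<^bsub>M\<^esub>"
  using rsmult_l_distr[of "\<zero>\<^bsub>M\<^esub>" "\<zero>\<^bsub>M\<^esub>" a] rsmult_closed[of "\<zero>\<^bsub>M\<^esub>" a]
  by (metis M.add.r_cancel_one' M.l_zero M.zero_closed)

lemma carrier_right_submodule: "right_submodule R M (carrier M)"
  by (simp add: right_submodule_def rsmult_closed additive_subgroup_def M.add.subgroup_self)

lemma zero_right_submodule: "right_submodule R M {\<zero>\<^bsub>M\<^esub>}"
  using M.add.triv_subgroup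
  by (simp add: right_submodule_def zero_rsmult additive_subgroup_def)

lemma right_submodule_additive_subgroup: "right_submodule R M N \<Longrightarrow> additive_subgroup N M"
  by (simp add: right_submodule_def)

lemma right_submodule_subset: "right_submodule R M N \<Longrightarrow> N \<subseteq> carrier M"
  by (simp add: right_submodule_def additive_subgroup.a_subset)

text \<open>Every submodule \<open>N\<close> satisfies \<open>carrier M \<inter> N = N\<close>. The
  same identity shows below that only the zero submodule meets \<open>carrier M\<close>
  trivially.\<close>

lemma essential_carrier: "essential_submodule R M (carrier M)"
  unfolding essential_submodule_def
  using carrier_right_submodule right_submodule_subset by (metis inf.absorb2)

lemma complement_carrier_zero: "complement_submodule R M (carrier M) {\<zero>\<^bsub>M\<^esub>}"
  unfolding complement_submodule_def
  using carrier_right_submodule zero_right_submodule right_submodule_subset M.zero_closed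
  by (metis inf.absorb2)

lemma closed_carrier: "closed_submodule R M (carrier M)"
  unfolding closed_submodule_def complement_submodule_def
  using carrier_right_submodule zero_right_submodule right_submodule_subset
  \<comment> \<open>The whole module is a complement of zero: maximality holds because no submodule
    is larger.\<close>
  by (intro exI[of _ "{\<zero>\<^bsub>M\<^esub>}"]) (auto dest: subset_antisym)

text \<open>The modular law above gives maximality of \<open>D\<close>. For arbitrary modules a
  complement need not be a direct summand; in the theorem the converse comes from counting.\<close>

lemma complement_if_direct_sum:
  assumes "right_submodule R M C" and "right_submodule R M D"
    and "C <+>\<^bsub>M\<^esub> D = carrier M" and "C \<inter> D = {\<zero>\<^bsub>M\<^esub>}"
  shows "complement_submodule R M C D"
  unfolding complement_submodule_def
  using assms M.eq_if_disjoint_summand_le right_submodule_additive_subgroup by blast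

end

lemma right_module_free_right_module:
  assumes "ring R"
  shows "right_module R (free_right_module R n)"
proof -
  interpret R: ring R by fact
  let ?V = "free_right_module R n"
  have carr: "x i \<in> carrier R" if "x \<in> carrier ?V" "i < n" for x i
    using that by (auto simp: free_right_module_def)
  \<comment> \<open>Vectors are \<open>undefined\<close> outside \<open>{..<n}\<close>, so agreement
    below \<open>n\<close> is equality. Each module axiom thereby reduces to a ring axiom in every
    coordinate.\<close>
  have ext: "x = y" if "x \<in> carrier ?V" "y \<in> carrier ?V" "\<And>i. i < n \<Longrightarrow> x i = y i" for x y
    using that by (auto simp: free_right_module_def intro: PiE_ext)
  have zero: "\<zero>\<^bsub>?V\<^esub> \<in> carrier ?V" and zero_nth: "\<And>i. i < n \<Longrightarrow> \<zero>\<^bsub>?V\<^esub> i = \<zero>\<^bsub>R\<^esub>"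
    by (auto simp: free_right_module_def)
  have add: "x \<oplus>\<^bsub>?V\<^esub> y \<in> carrier ?V" if "x \<in> carrier ?V" "y \<in> carrier ?V" for x y
    using that by (auto simp: free_right_module_def)
  have add_nth: "(x \<oplus>\<^bsub>?V\<^esub> y) i = x i \<oplus>\<^bsub>R\<^esub> y i" if "i < n" for x y i
    using that by (simp add: free_right_module_def)
  have smult: "x \<odot>\<^sub>r\<^bsub>?V\<^esub> a \<in> carrier ?V" if "x \<in> carrier ?V" "a \<in> carrier R" for x a
    using that by (auto simp: free_right_module_def)
  have smult_nth: "(x \<odot>\<^sub>r\<^bsub>?V\<^esub> a) i = x i \<otimes>\<^bsub>R\<^esub> a" if "i < n" for x a i
    using that by (simp add: free_right_module_def)
  have inv: "\<exists>y\<in>carrier ?V. y \<oplus>\<^bsub>?V\<^esub> x = \<zero>\<^bsub>?V\<^esub>" if x: "x \<in> carrier ?V" for x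
  proof
    \<comment> \<open>The inverse is taken coordinatewise; \<open>abelian_groupI\<close> asks for a
      left inverse.\<close>
    show y: "(\<lambda>i\<in>{..<n}. \<ominus>\<^bsub>R\<^esub> x i) \<in> carrier ?V"
      using x by (auto simp: free_right_module_def)
    show "(\<lambda>i\<in>{..<n}. \<ominus>\<^bsub>R\<^esub> x i) \<oplus>\<^bsub>?V\<^esub> x = \<zero>\<^bsub>?V\<^esub>"
      by (rule ext) (simp_all add: x y add zero add_nth zero_nth carr R.l_neg)
  qed
  interpret V: abelian_group ?V
  proof (rule abelian_groupI)
    fix x y z assume x: "x \<in> carrier ?V" and y: "y \<in> carrier ?V" and z: "z \<in> carrier ?V"
    show "x \<oplus>\<^bsub>?V\<^esub> y \<oplus>\<^bsub>?V\<^esub> z = x \<oplus>\<^bsub>?V\<^esub> (y \<oplus>\<^bsub>?V\<^esub> z)"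
      by (rule ext) (simp_all add: x y z add add_nth carr R.a_assoc)
  next
    fix x y assume x: "x \<in> carrier ?V" and y: "y \<in> carrier ?V"
    show "x \<oplus>\<^bsub>?V\<^esub> y = y \<oplus>\<^bsub>?V\<^esub> x"
      by (rule ext) (simp_all add: x y add add_nth carr R.a_comm)
  next
    fix x assume x: "x \<in> carrier ?V"
    show "\<zero>\<^bsub>?V\<^esub> \<oplus>\<^bsub>?V\<^esub> x = x"
      by (rule ext) (simp_all add: x add zero add_nth zero_nth carr)
  qed (fact add zero inv)+
  show ?thesis
  proof unfold_locales
    fix x y a assume x: "x \<in> carrier ?V" and y: "y \<in> carrier ?V" and a: "a \<in> carrier R"
    show "(x \<oplus>\<^bsub>?V\<^esub> y) \<odot>\<^sub>r\<^bsub>?V\<^esub> a = (x \<odot>\<^sub>r\<^bsub>?V\<^esub> a) \<oplus>\<^bsub>?V\<^esub> (y \<odot>\<^sub>r\<^bsub>?V\<^esub> a)"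
      by (rule ext) (simp_all add: x y a add smult add_nth smult_nth carr R.l_distr)
  next
    fix x a b assume x: "x \<in> carrier ?V" and a: "a \<in> carrier R" and b: "b \<in> carrier R"
    show "x \<odot>\<^sub>r\<^bsub>?V\<^esub> (a \<oplus>\<^bsub>R\<^esub> b) = (x \<odot>\<^sub>r\<^bsub>?V\<^esub> a) \<oplus>\<^bsub>?V\<^esub> (x \<odot>\<^sub>r\<^bsub>?V\<^esub> b)"
      by (rule ext) (simp_all add: x a b add smult add_nth smult_nth carr R.r_distr)
    show "x \<odot>\<^sub>r\<^bsub>?V\<^esub> (a \<otimes>\<^bsub>R\<^esub> b) = (x \<odot>\<^sub>r\<^bsub>?V\<^esub> a) \<odot>\<^sub>r\<^bsub>?V\<^esub> b"
      by (rule ext) (simp_all add: x a b smult smult_nth carr R.m_assoc)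
  next
    fix x assume x: "x \<in> carrier ?V"
    show "x \<odot>\<^sub>r\<^bsub>?V\<^esub> \<one>\<^bsub>R\<^esub> = x"
      by (rule ext) (simp_all add: x smult smult_nth carr)
  qed (fact smult)
qed

theorem theorem4p12:
  fixes R :: "('a, 'r) ring_scheme" and n :: nat and C D :: "(nat \<Rightarrow> 'a) set"
  assumes "finite (carrier R)" and "frobenius_ring R"
    and "n > 0"
    and "linear_code R n C" and "linear_code R n D"
    and "card C * card D = card (carrier (free_right_module R n))"
  shows "let V = free_right_module R n in
         (lcp R n C D \<longleftrightarrow>
            C \<inter> D = {\<zero>\<^bsub>V\<^esub>} \<and> essential_submodule R V (C <+>\<^bsub>V\<^esub> D)) \<and>
         (lcp R n C D \<longleftrightarrow>
            C \<inter> D = {\<zero>\<^bsub>V\<^esub>} \<and> complement_submodule R V (C <+>\<^bsub>V\<^esub> D) {\<zero>\<^bsub>V\<^esub>}) \<and>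
         (lcp R n C D \<longleftrightarrow> complement_submodule R V C D) \<and>
         (lcp R n C D \<longleftrightarrow>
            C \<inter> D = {\<zero>\<^bsub>V\<^esub>} \<and> closed_submodule R V (C <+>\<^bsub>V\<^esub> D))"
proof -
  define V where "V = free_right_module R n"
  interpret V: right_module R V
    unfolding V_def using assms(2)
    by (intro right_module_free_right_module) (simp add: frobenius_ring_def)
  have C: "right_submodule R V C" and D: "right_submodule R V D"
    using assms(4,5) by (simp_all add: linear_code_def V_def)
  \<comment> \<open>Finiteness gives the cardinality hypothesis its force, as \<open>card\<close> is
    0 on infinite sets.\<close>
  have fin: "finite (carrier V)"
    using assms(1) by (simp add: V_def free_right_module_def finite_PiE)
  have sum: "C <+>\<^bsub>V\<^esub> D = carrier V" if "C \<inter> D = {\<zero>\<^bsub>V\<^esub>}"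
    using V.M.set_add_eq_carrier_if_card[OF _ _ fin _ that] C D assms(6)
      V.right_submodule_additive_subgroup unfolding V_def by blast
  \<comment> \<open>Trivial intersection serves as the hub: every condition contains it, and by
    \<open>sum\<close> it already forces C + D to be everything.\<close>
  then have "lcp R n C D \<longleftrightarrow> C \<inter> D = {\<zero>\<^bsub>V\<^esub>}"
    by (auto simp: lcp_def V_def)
  \<comment> \<open>Left to right is part of the definition of a complement; right to left passes
    through \<open>sum\<close>.\<close>
  moreover have "complement_submodule R V C D \<longleftrightarrow> C \<inter> D = {\<zero>\<^bsub>V\<^esub>}"
    using V.complement_if_direct_sum[OF C D sum] by (auto simp: complement_submodule_def)
  ultimately show ?thesis
    \<comment> \<open>In the other three conditions \<open>sum\<close> replaces C + D by
      \<open>carrier V\<close>, which is essential, has zero as a complement and is closed.\<close>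
    unfolding Let_def V_def[symmetric]
    using sum V.essential_carrier V.complement_carrier_zero V.closed_carrier by auto
qed

end
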